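(* Let $R$ be a subset of $\mathbb{K}[[X]]$. Then $R$ is a standard basis of the ideal of $\mathbb{K}[[X]]$ it generates if and only if $F(R)$ is a confluent set of reduction operators.
   Context: Let $\mathbb{K}$ be a commutative field (with the discrete topology), $X=\{x_1,\dots,x_n\}$ a finite set of indeterminates, $\mathbb{K}[X]$ the commutative polynomial algebra and $\mathbb{K}[[X]]$ the algebra of commutative formal power series. Let $G$ be the set of commutative monomials over $X$. The support $\mathrm{supp}(f)$ of a series $f=\sum \alpha_m m$ is the set of monomials $m$ with $\alpha_m\neq 0$. Order and metric. Let $<$ be a monomial order (a well-order on $G$ compatible with multiplication) which is compatible with degrees: $\deg(m)<\deg(m')$ implies $m<m'$. Let $<_{\mathrm{red}}$ be the opposite order of $<$ ($m<_{\mathrm{red}}m'$ iff $m'<m$). Equip $\mathbb{K}[[X]]$ with the metric $\delta(f,g)=1/2^k$, with $k$ the smallest degree of a monomial occurring in $f-g$ (and $\delta(f,f)=0$); $\mathbb{K}[[X]]$ is the completion of $\mathbb{K}[X]$ for $\delta$. For nonzero $f\in\mathbb{K}[[X]]$, $\mathrm{lm}(f)$ is the greatest element of $\mathrm{supp}(f)$ for $<_{\mathrm{red}}$, i.e. the smallest for $<$. For a subset $E$, $\mathrm{lm}(E)$ is the set of leading monomials of nonzero elements of $E$. Standard basis. A standard basis of an ideal $I$ of $\mathbb{K}[[X]]$ is a generating set $R$ of $I$ such that $\mathrm{lm}(R)$ generates the monomial ideal $\mathrm{lm}(I)$, i.e. every element of $\mathrm{lm}(I)$ is divisible by an element of $\mathrm{lm}(R)$.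 Reduction operators. A reduction operator is a continuous linear projector $T$ of $\mathbb{K}[[X]]$ such that for every monomial $m$, $T(m)\neq m$ implies $m'<_{\mathrm{red}}m$ for every $m'\in\mathrm{supp}(T(m))$. Put $\mathrm{nf}(T)=\{m\in G\mid T(m)=m\}$. The map $T\mapsto\ker(T)$ is a bijection between reduction operators and closed subspaces of $\mathbb{K}[[X]]$, with inverse $\ker^{-1}$. For $f\in\mathbb{K}[[X]]$, $T(f)$ denotes the reduction operator whose kernel is the closure of the ideal generated by $f$, and $F(R)=\{T(f)\mid f\in R\}$. For a set $F$ of reduction operators, put $\wedge F=\ker^{-1}\big(\overline{\sum_{T\in F}\ker(T)}\big)$ and $\mathrm{nf}(F)=\bigcap_{T\in F}\mathrm{nf}(T)$; one has $\mathrm{nf}(\wedge F)\subseteq\mathrm{nf}(F)$. The set $F$ is confluent if $\mathrm{nf}(F)\setminus\mathrm{nf}(\wedge F)=\emptyset$. *)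

theory Defs
  imports "HOL-Analysis.Elementary_Topology" "HOL-Library.Poly_Mapping"
begin

section \<open>Commutative monomials\<close>

text \<open>
  The finite set of indeterminates is the type \<open>'x :: finite\<close>. A monomial is its exponent
  vector, so the product of monomials is written additively.
\<close>

type_synonym 'x monomial = "'x \<Rightarrow>\<^sub>0 nat"

definition deg :: "'x::finite monomial \<Rightarrow> nat" where
  "deg m = (\<Sum>x\<in>UNIV. Poly_Mapping.lookup m x)"

definition mdvd :: "'x monomial \<Rightarrow> 'x monomial \<Rightarrow> bool" where
  "mdvd u m \<longleftrightarrow> (\<exists>v. m = u + v)"

definition monomial_order :: "('x monomial \<Rightarrow> 'x monomial \<Rightarrow> bool) \<Rightarrow> bool" where
  "monomial_order lt \<longleftrightarrow> transp lt \<and> totalp lt \<and> wfp lt \<and> (\<forall>u v w. lt u v \<longrightarrow> lt (u + w) (v + w))"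

definition degree_compatible :: "('x::finite monomial \<Rightarrow> 'x monomial \<Rightarrow> bool) \<Rightarrow> bool" where
  "degree_compatible lt \<longleftrightarrow> (\<forall>m m'. deg m < deg m' \<longrightarrow> lt m m')"

abbreviation red :: "('x monomial \<Rightarrow> 'x monomial \<Rightarrow> bool) \<Rightarrow> 'x monomial \<Rightarrow> 'x monomial \<Rightarrow> bool" where
  "red lt \<equiv> lt\<inverse>\<inverse>"

lemma finite_add_decomp: "finite {(u, v). u + v = (m :: 'x::finite monomial)}"
proof -
  let ?A = "{u. \<exists>v. u + v = m}"
  have "Poly_Mapping.lookup ` ?A \<subseteq> (UNIV \<rightarrow>\<^sub>E {..Max (range (Poly_Mapping.lookup m))})"
  proof (clarsimp simp: PiE_def)
    fix u v :: "'x monomial" and x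
    have "Poly_Mapping.lookup u x \<le> Poly_Mapping.lookup (u + v) x" by (simp add: lookup_add)
    also have "\<dots> \<le> Max (range (Poly_Mapping.lookup (u + v)))" by (rule Max_ge) auto
    finally show "Poly_Mapping.lookup u x \<le> Max (range (Poly_Mapping.lookup (u + v)))" .
  qed
  then have "finite (Poly_Mapping.lookup ` ?A)"
    by (rule finite_subset) (intro finite_PiE finite_atMost finite)
  then have A: "finite ?A"
    by (rule finite_imageD) (simp add: inj_on_def lookup_inject)
  have "{(u, v). u + v = m} \<subseteq> ?A \<times> ?A"
    using add.commute by fastforce
  then show ?thesis using A by (meson finite_SigmaI finite_subset)
qed


section \<open>The algebra of commutative formal power series\<close>

typedef ('x, 'k) mfps = "UNIV :: ('x monomial \<Rightarrow> 'k) set"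
  morphisms coeff Abs_mfps by simp

lemma coeff_Abs_mfps [simp]: "coeff (Abs_mfps f) = f"
  by (simp add: Abs_mfps_inverse)

lemma mfps_eqI: "(\<And>m. coeff f m = coeff g m) \<Longrightarrow> f = g"
  by (metis coeff_inject ext)

lemma mfps_eq_iff: "f = g \<longleftrightarrow> (\<forall>m. coeff f m = coeff g m)"
  by (auto intro: mfps_eqI)

instantiation mfps :: (type, ab_group_add) ab_group_add
begin

definition "0 = Abs_mfps (\<lambda>_. 0)"
definition "f + g = Abs_mfps (\<lambda>m. coeff f m + coeff g m)"
definition "- f = Abs_mfps (\<lambda>m. - coeff f m)"
definition "f - g = Abs_mfps (\<lambda>m. coeff f m - coeff g m)"

instance
  by standard
    (simp_all add: mfps_eq_iff zero_mfps_def plus_mfps_def uminus_mfps_def minus_mfps_def)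

end

lemma coeff_0 [simp]: "coeff 0 m = 0"
  and coeff_add [simp]: "coeff (f + g) m = coeff f m + coeff g m"
  and coeff_uminus [simp]: "coeff (- f) m = - coeff f m"
  and coeff_diff [simp]: "coeff (f - g) m = coeff f m - coeff g m"
  by (simp_all add: zero_mfps_def plus_mfps_def uminus_mfps_def minus_mfps_def)

definition monom :: "'x monomial \<Rightarrow> ('x, 'k::zero_neq_one) mfps" where
  "monom m = Abs_mfps (\<lambda>u. if u = m then 1 else 0)"

lemma coeff_monom: "coeff (monom m) u = (if u = m then 1 else 0)"
  by (simp add: monom_def)

definition scale :: "'k::times \<Rightarrow> ('x, 'k) mfps \<Rightarrow> ('x, 'k) mfps" where
  "scale c f = Abs_mfps (\<lambda>m. c * coeff f m)"

lemma coeff_scale [simp]: "coeff (scale c f) m = c * coeff f m"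
  by (simp add: scale_def)

instantiation mfps :: (finite, comm_ring_1) comm_ring_1
begin

definition "1 = monom 0"
definition "f * g = Abs_mfps (\<lambda>m. \<Sum>(u, v) | u + v = m. coeff f u * coeff g v)"

instance
proof
  define S where "S m = {(u, v). u + v = (m :: 'a monomial)}" for m
  have fin [simp]: "finite (S m)" for m
    by (simp add: S_def finite_add_decomp)
  have in_S [simp]: "(u, v) \<in> S m \<longleftrightarrow> u + v = m" for u v m
    by (simp add: S_def)
  have cm: "coeff (f * g) m = (\<Sum>(u, v)\<in>S m. coeff f u * coeff g v)"
    for f g :: "('a, 'b) mfps" and m
    by (simp add: times_mfps_def S_def)
  fix a b c :: "('a, 'b) mfps"
  show "a * b * c = a * (b * c)"
  proof (rule mfps_eqI)
    fix m
    have "coeff (a * b * c) m =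
        (\<Sum>p\<in>S m. \<Sum>q\<in>S (fst p). coeff a (fst q) * coeff b (snd q) * coeff c (snd p))"
      by (simp add: cm sum_distrib_right case_prod_beta)
    also have "\<dots> = (\<Sum>(p, q)\<in>Sigma (S m) (\<lambda>p. S (fst p)).
        coeff a (fst q) * coeff b (snd q) * coeff c (snd p))"
      by (rule sum.Sigma) auto
    also have "\<dots> = (\<Sum>(p, q)\<in>Sigma (S m) (\<lambda>p. S (snd p)).
        coeff a (fst p) * coeff b (fst q) * coeff c (snd q))"
      by (rule sum.reindex_bij_witness
          [of _ "\<lambda>((u, q), (v, w)). ((u + v, w), (u, v))" "\<lambda>((p, w), (u, v)). ((u, v + w), (v, w))"])
        (auto simp: add.assoc)
    also have "\<dots> = (\<Sum>p\<in>S m. \<Sum>q\<in>S (snd p). coeff a (fst p) * coeff b (fst q) * coeff c (snd q))"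
      by (rule sum.Sigma [symmetric]) auto
    also have "\<dots> = coeff (a * (b * c)) m"
      by (simp add: cm sum_distrib_left case_prod_beta mult.assoc)
    finally show "coeff (a * b * c) m = coeff (a * (b * c)) m" .
  qed
  show "a * b = b * a"
  proof (rule mfps_eqI)
    fix m
    show "coeff (a * b) m = coeff (b * a) m"
      unfolding cm
      by (rule sum.reindex_bij_witness [of _ "\<lambda>(u, v). (v, u)" "\<lambda>(u, v). (v, u)"])
        (auto simp: add.commute mult.commute)
  qed
  show "(a + b) * c = a * c + b * c"
    by (rule mfps_eqI) (simp add: cm case_prod_beta distrib_right sum.distrib)
  show "1 * a = a"
  proof (rule mfps_eqI)
    fix m
    have "coeff (1 * a) m = (\<Sum>(u, v)\<in>{(0, m)}. coeff (1 :: ('a, 'b) mfps) u * coeff a v)"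
      unfolding cm
      by (rule sum.mono_neutral_right) (auto simp: one_mfps_def coeff_monom split: if_splits)
    then show "coeff (1 * a) m = coeff a m" by (simp add: one_mfps_def coeff_monom)
  qed
  show "(0 :: ('a, 'b) mfps) \<noteq> 1"
    by (auto simp: one_mfps_def mfps_eq_iff coeff_monom)
qed

end

definition supp :: "('x, 'k::zero) mfps \<Rightarrow> 'x monomial set" where
  "supp f = {m. coeff f m \<noteq> 0}"

global_interpretation mfps_vs: vector_space "scale :: 'k::field \<Rightarrow> ('x, 'k) mfps \<Rightarrow> ('x, 'k) mfps"
  by standard (simp_all add: mfps_eq_iff algebra_simps)

global_interpretation mfps_ideal:
  module "(*) :: ('x::finite, 'k::comm_ring_1) mfps \<Rightarrow> ('x, 'k) mfps \<Rightarrow> ('x, 'k) mfps"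
  by standard (simp_all add: algebra_simps)

abbreviation ideal_of :: "('x::finite, 'k::comm_ring_1) mfps set \<Rightarrow> ('x, 'k) mfps set" where
  "ideal_of \<equiv> mfps_ideal.span"


section \<open>The metric\<close>

instantiation mfps :: (finite, ab_group_add) metric_space
begin

definition dist_mfps_def:
  "dist f g = (if f = g then 0 else 1 / 2 ^ (LEAST k. \<exists>m\<in>supp (f - g). deg m = k) :: real)"

definition uniformity_mfps_def:
  "(uniformity :: (('a, 'b) mfps \<times> ('a, 'b) mfps) filter) =
    (INF e\<in>{0 <..}. principal {(x, y). dist x y < e})"

definition open_mfps_def:
  "open (U :: ('a, 'b) mfps set) \<longleftrightarrow>
    (\<forall>x\<in>U. eventually (\<lambda>(x', y). x' = x \<longrightarrow> y \<in> U) uniformity)"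

instance
proof
  let ?v = "\<lambda>f :: ('a, 'b) mfps. LEAST k. \<exists>m\<in>supp f. deg m = k"
  show eq0: "dist f g = 0 \<longleftrightarrow> f = g" for f g :: "('a, 'b) mfps"
    by (simp add: dist_mfps_def)
  fix f g h :: "('a, 'b) mfps"
  have le: "dist f g \<le> 1 / 2 ^ n \<longleftrightarrow> (\<forall>m. deg m < n \<longrightarrow> coeff f m = coeff g m)"
    for f g :: "('a, 'b) mfps" and n
  proof (cases "f = g")
    case False
    let ?P = "\<lambda>k. \<exists>m\<in>supp (f - g). deg m = k"
    obtain m0 where "coeff f m0 \<noteq> coeff g m0" using False mfps_eqI by blast
    then have "?P (deg m0)" by (auto simp: supp_def)
    then have "?P (?v (f - g))" by (rule LeastI)
    then obtain m1 where m1: "coeff f m1 \<noteq> coeff g m1" "deg m1 = ?v (f - g)"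
      by (auto simp: supp_def)
    have least: "?v (f - g) \<le> deg m" if "coeff f m \<noteq> coeff g m" for m
      by (rule Least_le) (use that in \<open>auto simp: supp_def\<close>)
    have "dist f g \<le> 1 / 2 ^ n \<longleftrightarrow> n \<le> ?v (f - g)"
      using False by (simp add: dist_mfps_def divide_simps)
    also have "\<dots> \<longleftrightarrow> (\<forall>m. deg m < n \<longrightarrow> coeff f m = coeff g m)"
    proof
      assume "n \<le> ?v (f - g)"
      then show "\<forall>m. deg m < n \<longrightarrow> coeff f m = coeff g m"
        using least by (meson leD order.trans)
    next
      assume "\<forall>m. deg m < n \<longrightarrow> coeff f m = coeff g m"
      then show "n \<le> ?v (f - g)" using m1 by (metis not_less)
    qed
    finally show ?thesis .
  qed (simp add: dist_mfps_def)
  show "dist f g \<le> dist f h + dist g h"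
  proof (cases "f = h \<or> g = h")
    case True
    have "supp (g - f) = supp (f - g)"
      by (auto simp: supp_def)
    then have "dist g f = dist f g"
      by (auto simp: dist_mfps_def)
    with True show ?thesis by (auto simp: dist_mfps_def)
  next
    case False
    define p where "p = ?v (f - h)"
    define q where "q = ?v (g - h)"
    have d: "dist f h = 1 / 2 ^ p" "dist g h = 1 / 2 ^ q"
      using False by (simp_all add: dist_mfps_def p_def q_def)
    then have "\<forall>m. deg m < p \<longrightarrow> coeff f m = coeff h m" "\<forall>m. deg m < q \<longrightarrow> coeff g m = coeff h m"
      using le [of f h p] le [of g h q] by auto
    then have "dist f g \<le> 1 / 2 ^ min p q"
      by (subst le) auto
    also have "\<dots> \<le> 1 / 2 ^ p + 1 / (2 ^ q :: real)"
      by (simp add: min_def)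
    finally show ?thesis by (simp add: d)
  qed
qed (rule open_mfps_def uniformity_mfps_def)+

end


section \<open>Standard bases\<close>

text \<open>The value of \<open>lm\<close> at \<open>0\<close> is unspecified; \<open>lm_set\<close> only uses nonzero series.\<close>

definition lm :: "('x monomial \<Rightarrow> 'x monomial \<Rightarrow> bool) \<Rightarrow> ('x, 'k::zero) mfps \<Rightarrow> 'x monomial" where
  "lm lt f = (THE m. m \<in> supp f \<and> (\<forall>m'\<in>supp f. m' \<noteq> m \<longrightarrow> red lt m' m))"

definition lm_set ::
  "('x monomial \<Rightarrow> 'x monomial \<Rightarrow> bool) \<Rightarrow> ('x, 'k::ab_group_add) mfps set \<Rightarrow> 'x monomial set" where
  "lm_set lt E = lm lt ` (E - {0})"

definition standard_basis ::
  "('x::finite monomial \<Rightarrow> 'x monomial \<Rightarrow> bool) \<Rightarrow> ('x, 'k::field) mfps set \<Rightarrow> ('x, 'k) mfps set \<Rightarrow> bool" where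
  "standard_basis lt I R \<longleftrightarrow>
    ideal_of R = I \<and> (\<forall>m\<in>lm_set lt I. \<exists>u\<in>lm_set lt R. mdvd u m)"


section \<open>Reduction operators\<close>

type_synonym ('x, 'k) mfps_op = "('x, 'k) mfps \<Rightarrow> ('x, 'k) mfps"

definition reduction_operator ::
  "('x::finite monomial \<Rightarrow> 'x monomial \<Rightarrow> bool) \<Rightarrow> ('x, 'k::field) mfps_op \<Rightarrow> bool" where
  "reduction_operator lt T \<longleftrightarrow>
    Vector_Spaces.linear scale scale T \<and> continuous_on UNIV T \<and> T \<circ> T = T \<and>
    (\<forall>m. T (monom m) \<noteq> monom m \<longrightarrow> (\<forall>m'\<in>supp (T (monom m)). red lt m' m))"

definition ker :: "('x, 'k::field) mfps_op \<Rightarrow> ('x, 'k) mfps set" where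
  "ker T = {f. T f = 0}"

definition ker_inv ::
  "('x::finite monomial \<Rightarrow> 'x monomial \<Rightarrow> bool) \<Rightarrow> ('x, 'k::field) mfps set \<Rightarrow> ('x, 'k) mfps_op" where
  "ker_inv lt = the_inv_into {T. reduction_operator lt T} ker"

definition op_of ::
  "('x::finite monomial \<Rightarrow> 'x monomial \<Rightarrow> bool) \<Rightarrow> ('x, 'k::field) mfps \<Rightarrow> ('x, 'k) mfps_op" where
  "op_of lt f = ker_inv lt (closure (ideal_of {f}))"

definition nf :: "('x, 'k::field) mfps_op \<Rightarrow> 'x monomial set" where
  "nf T = {m. T (monom m) = monom m}"

definition nf_set :: "('x, 'k::field) mfps_op set \<Rightarrow> 'x monomial set" where
  "nf_set F = (\<Inter>T\<in>F. nf T)"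

text \<open>The algebraic sum of the (possibly infinite) family of subspaces \<open>ker T\<close>, \<open>T \<in> F\<close>.\<close>

definition ker_sum :: "('x, 'k::field) mfps_op set \<Rightarrow> ('x, 'k) mfps set" where
  "ker_sum F = {(\<Sum>T\<in>S. g T) | S g. finite S \<and> S \<subseteq> F \<and> (\<forall>T\<in>S. g T \<in> ker T)}"

definition meet ::
  "('x::finite monomial \<Rightarrow> 'x monomial \<Rightarrow> bool) \<Rightarrow> ('x, 'k::field) mfps_op set \<Rightarrow> ('x, 'k) mfps_op" where
  "meet lt F = ker_inv lt (closure (ker_sum F))"

definition confluent ::
  "('x::finite monomial \<Rightarrow> 'x monomial \<Rightarrow> bool) \<Rightarrow> ('x, 'k::field) mfps_op set \<Rightarrow> bool" where
  "confluent lt F \<longleftrightarrow> (\<forall>T\<in>F. reduction_operator lt T) \<and> nf_set F - nf (meet lt F) = {}"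

end

theory Submission
  imports Defs "HOL-Analysis.Elementary_Metric_Spaces"
begin

text \<open>
  Both sides say that every leading monomial of the ideal \<open>I\<close> generated by \<open>R\<close> is a
  multiple of some leading monomial of \<open>R\<close>. This is the definition of a standard basis, so what
  remains is to read confluence in terms of leading monomials.

  The bridge is that a reduction operator \<open>T\<close> moves exactly the leading monomials of its
  kernel (\<open>nf_reduction_operator\<close>). If \<open>T\<close> moves \<open>m\<close>, then \<open>m - T m\<close> lies in the kernel
  and has leading monomial \<open>m\<close>; conversely, no \<open>f\<close> in the kernel can have a leading monomial
  fixed by \<open>T\<close>, because \<open>T\<close> sends the other monomials of \<open>f\<close> to series in which that monomial
  does not occur. Leading monomials do not change when a subspace is replaced by its
  closure: the order is compatible with degrees, so a series near \<open>f\<close> has the same leading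
  monomial as \<open>f\<close> (\<open>lm_set_closure\<close>).

  Hence the monomials moved by the operator of \<open>f\<close> are those of the principal ideal
  generated by \<open>f\<close>, that is, the multiples of \<open>lm f\<close> (\<open>lm_set_principal_ideal\<close>), and
  the normal forms of the family are the monomials divisible by no leading monomial of \<open>R\<close>.
  On the other side, the sum of the kernels lies between \<open>I\<close> and its closure
  (\<open>closure_span_closures\<close>), so the meet of the family moves exactly the leading monomials
  of \<open>I\<close>. The normal forms of the meet are always normal forms of the family, and confluence
  is the reverse inclusion: a leading monomial of \<open>I\<close> is a multiple of one of \<open>R\<close>.

  For these operators to exist, each closed subspace \<open>V\<close> must be the kernel of exactly one
  reduction operator. Existence is the division of a series by elements of \<open>V\<close>, one for each
  leading monomial, continued transfinitely along the monomial order (\<open>ex_normal_form\<close>).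
  Uniqueness holds because a reduction operator takes its values in the series supported on
  its normal forms, and these form a complement of \<open>V\<close> (\<open>inj_on_ker\<close>).
\<close>


section \<open>The topology in terms of coefficients\<close>

definition agree ::
  "nat \<Rightarrow> ('x::finite, 'k::ab_group_add) mfps \<Rightarrow> ('x, 'k) mfps \<Rightarrow> bool" where
  "agree n f g \<longleftrightarrow> (\<forall>m. deg m < n \<longrightarrow> coeff f m = coeff g m)"

lemma dist_le_iff_agree: "dist f g \<le> 1 / 2 ^ n \<longleftrightarrow> agree n f g"
proof (cases "f = g")
  case True
  then show ?thesis by (simp add: agree_def)
next
  case False
  let ?P = "\<lambda>k. \<exists>m\<in>supp (f - g). deg m = k"
  have "\<exists>k. ?P k"
    using False by (auto simp: mfps_eq_iff supp_def)
  then have "?P (LEAST k. ?P k)"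
    by (rule LeastI_ex)
  moreover have "(LEAST k. ?P k) \<le> k" if "?P k" for k
    using that by (rule Least_le)
  ultimately have "n \<le> (LEAST k. ?P k) \<longleftrightarrow> (\<forall>k. ?P k \<longrightarrow> n \<le> k)"
    using order_trans by blast
  also have "\<dots> \<longleftrightarrow> agree n f g"
    unfolding agree_def supp_def by (force simp: not_less)
  finally show ?thesis
    using False by (simp add: dist_mfps_def divide_simps)
qed

lemma ex_power_half_less: "0 < e \<Longrightarrow> \<exists>n. 1 / 2 ^ n < (e :: real)"
  using real_arch_pow_inv [of e "1 / 2"] by (simp add: power_one_over)

lemma closure_iff_agree:
  fixes A :: "('x::finite, 'k::ab_group_add) mfps set"
  shows "f \<in> closure A \<longleftrightarrow> (\<forall>n. \<exists>g\<in>A. agree n g f)"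
  unfolding closure_approachable
proof safe
  fix n assume "\<forall>e>0. \<exists>g\<in>A. dist g f < e"
  then obtain g where "g \<in> A" "dist g f < 1 / 2 ^ n"
    by (auto dest: spec [of _ "1 / 2 ^ n"])
  then show "\<exists>g\<in>A. agree n g f"
    using dist_le_iff_agree less_imp_le by blast
next
  fix e :: real assume A: "\<forall>n. \<exists>g\<in>A. agree n g f" and "0 < e"
  then obtain n where "1 / 2 ^ n < e" using ex_power_half_less by blast
  with A show "\<exists>g\<in>A. dist g f < e"
    by (meson dist_le_iff_agree le_less_trans)
qed

text \<open>
  Linearity reduces continuity to continuity at \<open>0\<close>. In this form the property passes without
  effort to combinations such as \<open>T - id\<close>.
\<close>

lemma linear_continuous_iff_agree:
  fixes T :: "('x::finite, 'k::field) mfps_op"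
  assumes "Vector_Spaces.linear scale scale T"
  shows "continuous_on UNIV T \<longleftrightarrow> (\<forall>n. \<exists>N. \<forall>f. agree N f 0 \<longrightarrow> agree n (T f) 0)"
proof -
  interpret T: Vector_Spaces.linear scale scale T by fact
  show ?thesis
  proof safe
    fix n assume "continuous_on UNIV T"
    then obtain d where "d > 0" and d: "\<And>f. dist f 0 < d \<Longrightarrow> dist (T f) (T 0) < 1 / 2 ^ n"
      unfolding continuous_on_iff by (fastforce dest: bspec [of _ _ 0] spec [of _ "1 / 2 ^ n"])
    obtain N where "1 / 2 ^ N < d" using ex_power_half_less \<open>d > 0\<close> by blast
    then have "agree n (T f) 0" if "agree N f 0" for f
      using d [of f] that T.zero
      by (metis dist_le_iff_agree le_less_trans less_imp_le)
    then show "\<exists>N. \<forall>f. agree N f 0 \<longrightarrow> agree n (T f) 0" by blast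
  next
    assume *: "\<forall>n. \<exists>N. \<forall>f. agree N f 0 \<longrightarrow> agree n (T f) 0"
    show "continuous_on UNIV T"
      unfolding continuous_on_iff
    proof safe
      fix f :: "('x, 'k) mfps" and e :: real assume "0 < e"
      then obtain n where n: "1 / 2 ^ n < e" using ex_power_half_less by blast
      obtain N where N: "\<And>f. agree N f 0 \<Longrightarrow> agree n (T f) 0" using * by blast
      have "dist (T g) (T f) < e" if "dist g f < 1 / 2 ^ N" for g
      proof -
        have "agree N g f" using that dist_le_iff_agree less_imp_le by blast
        then have "agree n (T (g - f)) 0" by (intro N) (simp add: agree_def)
        then have "agree n (T g) (T f)" by (simp add: agree_def T.diff)
        then show ?thesis using n by (meson dist_le_iff_agree le_less_trans)
      qed
      then show "\<exists>d>0. \<forall>g\<in>UNIV. dist g f < d \<longrightarrow> dist (T g) (T f) < e"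
        by (intro exI [of _ "1 / 2 ^ N"]) simp
    qed
  qed
qed

lemma finite_deg_less: "finite {m :: 'x::finite monomial. deg m < n}"
proof -
  have "Poly_Mapping.lookup ` {m :: 'x monomial. deg m < n} \<subseteq> (UNIV \<rightarrow>\<^sub>E {..<n})"
  proof (clarsimp simp: PiE_def)
    fix m :: "'x monomial" and x
    assume "deg m < n"
    moreover have "Poly_Mapping.lookup m x \<le> deg m"
      unfolding deg_def by (rule member_le_sum) auto
    ultimately show "Poly_Mapping.lookup m x < n" by simp
  qed
  then have "finite (Poly_Mapping.lookup ` {m :: 'x monomial. deg m < n})"
    by (rule finite_subset) (intro finite_PiE finite_lessThan finite)
  then show ?thesis
    by (rule finite_imageD) (simp add: inj_on_def lookup_inject)
qed

lemma coeff_sum: "coeff (\<Sum>a\<in>A. h a) m = (\<Sum>a\<in>A. coeff (h a) m)"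
  by (induction A rule: infinite_finite_induct) auto

text \<open>
  By continuity, a single coefficient of \<open>T f\<close> depends only on a truncation of \<open>f\<close>, which is a
  finite combination of monomials. So a conclusion about infinite linear combinations may be
  drawn monomial by monomial, without any convergence of series.
\<close>

lemma coeff_continuous_linear:
  fixes T :: "('x::finite, 'k::field) mfps_op"
  assumes lin: "Vector_Spaces.linear scale scale T"
    and cont: "\<forall>n. \<exists>N. \<forall>f. agree N f 0 \<longrightarrow> agree n (T f) 0"
    and zero: "\<And>m. coeff f m \<noteq> 0 \<Longrightarrow> coeff (T (monom m)) u = 0"
  shows "coeff (T f) u = 0"
proof -
  interpret T: Vector_Spaces.linear scale scale T by fact
  obtain N where N: "\<And>f. agree N f 0 \<Longrightarrow> agree (Suc (deg u)) (T f) 0" using cont by blast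
  define p where "p = (\<Sum>m | deg m < N. scale (coeff f m) (monom m))"
  have "coeff p v = (\<Sum>m | deg m < N. if v = m then coeff f m else 0)" for v
    unfolding p_def coeff_sum by (rule sum.cong) (auto simp: coeff_monom)
  then have "agree N (f - p) 0"
    by (auto simp: agree_def sum.delta' finite_deg_less)
  then have "agree (Suc (deg u)) (T (f - p)) 0" by (rule N)
  then have "coeff (T f) u = coeff (T p) u"
    by (simp add: agree_def T.diff)
  also have "\<dots> = (\<Sum>m | deg m < N. coeff f m * coeff (T (monom m)) u)"
    by (simp add: p_def T.sum T.scale coeff_sum)
  also have "\<dots> = 0"
    using zero by (intro sum.neutral) auto
  finally show ?thesis .
qed

lemma subspace_closure:
  fixes V :: "('x::finite, 'k::field) mfps set"
  assumes V: "mfps_vs.subspace V"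
  shows "mfps_vs.subspace (closure V)"
proof (rule mfps_vs.subspaceI)
  show "0 \<in> closure V"
    using mfps_vs.subspace_0 [OF V] closure_subset by blast
next
  fix f g assume "f \<in> closure V" "g \<in> closure V"
  then show "f + g \<in> closure V"
    unfolding closure_iff_agree
    by (auto simp: agree_def) (metis (full_types) V coeff_add mfps_vs.subspace_add)
next
  fix c f assume "f \<in> closure V"
  then show "scale c f \<in> closure V"
    unfolding closure_iff_agree
    by (auto simp: agree_def) (metis (full_types) V coeff_scale mfps_vs.subspace_scale)
qed


section \<open>Leading monomials\<close>

text \<open>
  A relational version of \<open>lm\<close>: it spares the definite description and already
  excludes the zero series.
\<close>

definition is_lm ::
  "('x monomial \<Rightarrow> 'x monomial \<Rightarrow> bool) \<Rightarrow> ('x, 'k::zero) mfps \<Rightarrow> 'x monomial \<Rightarrow> bool" where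
  "is_lm lt f m \<longleftrightarrow> coeff f m \<noteq> 0 \<and> (\<forall>u. lt u m \<longrightarrow> coeff f u = 0)"

locale degree_order =
  fixes lt :: "'x::finite monomial \<Rightarrow> 'x monomial \<Rightarrow> bool"
  assumes order: "monomial_order lt" and degree: "degree_compatible lt"
begin

lemma trans: "lt u v \<Longrightarrow> lt v w \<Longrightarrow> lt u w"
  using order unfolding monomial_order_def transp_def by blast

lemma total: "u = v \<or> lt u v \<or> lt v u"
  using order unfolding monomial_order_def totalp_on_def by blast

lemma wf: "wfp lt"
  using order by (simp add: monomial_order_def)

lemma irrefl: "\<not> lt u u"
  using wfp_imp_irreflp [OF wf] by (simp add: irreflp_on_def)

lemma add_right: "lt u v \<Longrightarrow> lt (u + w) (v + w)"
  using order by (simp add: monomial_order_def)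

lemma deg_mono:
  assumes "lt u v"
  shows "deg u \<le> deg v"
proof (rule ccontr)
  assume "\<not> deg u \<le> deg v"
  then have "lt v u" using degree by (simp add: degree_compatible_def)
  with assms show False using trans [of u v u] irrefl [of u] by blast
qed

lemma finite_below: "finite {u. lt u m}"
  by (rule finite_subset [OF _ finite_deg_less [of "Suc (deg m)"]])
    (auto simp: less_Suc_eq_le deg_mono)

lemma ex_is_lm:
  assumes "f \<noteq> 0"
  shows "\<exists>m. is_lm lt f m"
proof -
  obtain m0 where "coeff f m0 \<noteq> 0" using assms by (auto simp: mfps_eq_iff)
  then show ?thesis
    using wf [unfolded wfp_eq_minimal, rule_format, of m0 "{m. coeff f m \<noteq> 0}"]
    by (auto simp: is_lm_def)
qed

lemma lm_eqI:
  assumes "is_lm lt f m"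
  shows "lm lt f = m"
  unfolding lm_def
proof (rule the_equality)
  show "m \<in> supp f \<and> (\<forall>m'\<in>supp f. m' \<noteq> m \<longrightarrow> red lt m' m)"
  proof (intro conjI ballI impI)
    show "m \<in> supp f" using assms by (simp add: is_lm_def supp_def)
  next
    fix u assume "u \<in> supp f" "u \<noteq> m"
    then show "red lt u m"
      using assms total [of u m] by (auto simp: is_lm_def supp_def)
  qed
next
  fix m'
  assume m': "m' \<in> supp f \<and> (\<forall>u\<in>supp f. u \<noteq> m' \<longrightarrow> red lt u m')"
  have "m \<in> supp f" "\<not> lt m' m"
    using assms m' by (auto simp: is_lm_def supp_def)
  moreover have "m \<in> supp f \<longrightarrow> m \<noteq> m' \<longrightarrow> lt m' m"
    using m' by simp
  ultimately show "m' = m" by blast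
qed

lemma lm_set_eq:
  fixes E :: "('x, 'b::ab_group_add) mfps set"
  shows "lm_set lt E = {m. \<exists>f\<in>E. is_lm lt f m}"
proof (intro set_eqI iffI)
  fix m assume "m \<in> lm_set lt E"
  then obtain f where "f \<in> E" "f \<noteq> 0" "m = lm lt f"
    unfolding lm_set_def by blast
  then show "m \<in> {m. \<exists>f\<in>E. is_lm lt f m}"
    using ex_is_lm lm_eqI by blast
next
  fix m assume "m \<in> {m. \<exists>f\<in>E. is_lm lt f m}"
  then obtain f where "f \<in> E" and f: "is_lm lt f m" by blast
  moreover have "f \<noteq> 0" using f by (auto simp: is_lm_def)
  ultimately show "m \<in> lm_set lt E"
    unfolding lm_set_def using lm_eqI [OF f] by blast
qed

text \<open>
  A series of the closure is approximated within \<open>E\<close> up to the degree of its leading monomial,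
  and all monomials below the leading one have at most this degree.
\<close>

lemma lm_set_closure: "lm_set lt (closure E) = lm_set lt E"
proof
  show "lm_set lt E \<subseteq> lm_set lt (closure E)"
    unfolding lm_set_eq using closure_subset by blast
  show "lm_set lt (closure E) \<subseteq> lm_set lt E"
  proof
    fix m assume "m \<in> lm_set lt (closure E)"
    then obtain f where "f \<in> closure E" and f: "is_lm lt f m"
      unfolding lm_set_eq by blast
    then obtain g where "g \<in> E" and g: "agree (Suc (deg m)) g f"
      unfolding closure_iff_agree by blast
    have "is_lm lt g m"
      using f g deg_mono by (auto simp: is_lm_def agree_def less_Suc_eq_le)
    with \<open>g \<in> E\<close> show "m \<in> lm_set lt E" by (auto simp: lm_set_eq)
  qed
qed

text \<open>
  The uniqueness principle behind all normal forms: a nonzero element of \<open>V\<close> contains its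
  own leading monomial.
\<close>

lemma eq_0_if_avoids_lm_set:
  assumes "f \<in> V" "\<And>m. m \<in> lm_set lt V \<Longrightarrow> coeff f m = 0"
  shows "f = 0"
  using assms ex_is_lm by (fastforce simp: lm_set_eq is_lm_def)

lemma is_lm_mult:
  fixes f g :: "('x, 'k::idom) mfps"
  assumes f: "is_lm lt f a" and g: "is_lm lt g b"
  shows "is_lm lt (f * g) (a + b)"
proof -
  (* Apart from the product of the two leading terms, each product of terms lies strictly
     above a + b. *)
  have zero: "coeff f u * coeff g v = 0"
    if w: "u + v = w" "w = a + b \<or> lt w (a + b)" and neq: "(u, v) \<noteq> (a, b)" for u v w
  proof (rule ccontr)
    assume "coeff f u * coeff g v \<noteq> 0"
    then have "\<not> lt u a" "\<not> lt v b" using f g by (auto simp: is_lm_def)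
    then consider "u = a" "lt b v" | "lt a u" "v = b" | "lt a u" "lt b v"
      using total [of u a] total [of v b] neq by blast
    then have "lt (a + b) (u + v)"
    proof cases
      case 1
      then show ?thesis using add_right [of b v a] by (simp add: add.commute)
    next
      case 2
      then show ?thesis using add_right [of a u b] by simp
    next
      case 3
      have "lt (a + b) (u + b)" using 3(1) by (rule add_right)
      moreover have "lt (u + b) (u + v)"
        using add_right [OF 3(2), of u] by (simp add: add.commute)
      ultimately show ?thesis by (rule trans)
    qed
    then show False using w irrefl [of w] trans [of w "a + b" w] by auto
  qed
  have "coeff (f * g) w = 0" if "lt w (a + b)" for w
    unfolding times_mfps_def coeff_Abs_mfps using zero [of _ _ w] that irrefl [of "a + b"]
    by (intro sum.neutral) (clarsimp, blast)
  moreover have "coeff (f * g) (a + b) = (\<Sum>(u, v)\<in>{(a, b)}. coeff f u * coeff g v)"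
    unfolding times_mfps_def coeff_Abs_mfps
  proof (rule sum.mono_neutral_right [OF finite_add_decomp])
    show "\<forall>p\<in>{(u, v). u + v = a + b} - {(a, b)}.
        (case p of (u, v) \<Rightarrow> coeff f u * coeff g v) = 0"
      using zero by (auto simp del: mult_eq_0_iff)
  qed auto
  ultimately show ?thesis
    using f g by (simp add: is_lm_def)
qed

lemma lm_set_principal_ideal:
  fixes f :: "('x, 'k::field) mfps"
  shows "lm_set lt (ideal_of {f}) = {m. \<exists>u\<in>lm_set lt {f}. mdvd u m}"
proof (intro set_eqI iffI)
  fix m assume "m \<in> lm_set lt (ideal_of {f})"
  then obtain g where g: "is_lm lt (g * f) m"
    by (auto simp: lm_set_eq mfps_ideal.span_singleton)
  then have "g \<noteq> 0" "f \<noteq> 0" by (auto simp: is_lm_def)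
  then obtain a b where a: "is_lm lt g a" and b: "is_lm lt f b" using ex_is_lm by meson
  have "m = a + b"
    using lm_eqI [OF g] lm_eqI [OF is_lm_mult [OF a b]] by simp
  with b show "m \<in> {m. \<exists>u\<in>lm_set lt {f}. mdvd u m}"
    by (auto simp: lm_set_eq mdvd_def add.commute)
next
  fix m assume "m \<in> {m. \<exists>u\<in>lm_set lt {f}. mdvd u m}"
  then obtain u v where u: "is_lm lt f u" and m: "m = u + v"
    by (auto simp: lm_set_eq mdvd_def)
  have "is_lm lt (monom v :: ('x, 'k) mfps) v"
    using irrefl by (auto simp: is_lm_def coeff_monom)
  then have "is_lm lt (monom v * f) m"
    unfolding m add.commute [of u] using u by (rule is_lm_mult)
  then show "m \<in> lm_set lt (ideal_of {f})"
    by (auto simp: lm_set_eq mfps_ideal.span_singleton)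
qed


section \<open>Reduction operators and closed subspaces\<close>

text \<open>
  Division of \<open>f\<close> by \<open>V\<close>. Choose in \<open>V\<close> a series \<open>b\<^sub>u\<close> for each of its leading monomials
  \<open>u\<close>, and look for the quotient \<open>h = \<Sum>\<^sub>u c\<^sub>u b\<^sub>u\<close>. Its coefficient at \<open>m\<close> involves only
  the \<open>c\<^sub>u\<close> with \<open>u \<le> m\<close>, which are finitely many, so requiring that \<open>f - h\<close> vanishes at
  \<open>m\<close> determines \<open>c\<^sub>m\<close> from the earlier coefficients. The infinite sum \<open>h\<close> is a limit of
  elements of \<open>V\<close>, which is where closedness enters.
\<close>

lemma ex_normal_form:
  fixes V :: "('x, 'k::field) mfps set"
  assumes V: "mfps_vs.subspace V" and closed: "closed V"
  shows "\<exists>g. f - g \<in> V \<and> (\<forall>m\<in>lm_set lt V. coeff g m = 0)"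
proof -
  let ?L = "lm_set lt V"
  have "\<exists>b. \<forall>m\<in>?L. b m \<in> V \<and> is_lm lt (b m) m"
    by (intro bchoice) (auto simp: lm_set_eq)
  then obtain b where bV: "\<And>m. m \<in> ?L \<Longrightarrow> b m \<in> V"
    and b: "\<And>m. m \<in> ?L \<Longrightarrow> is_lm lt (b m) m" by blast
  have "wf {(u, v). lt u v}" using wf by (simp add: wfp_def)
  then have "\<exists>c. \<forall>m. m \<in> ?L \<longrightarrow>
      c m * coeff (b m) m + (\<Sum>u | lt u m \<and> u \<in> ?L. c u * coeff (b u) m) = coeff f m"
  proof (rule dependent_wf_choice)
    fix c d :: "'x monomial \<Rightarrow> 'k" and m r
    assume "\<And>u. (u, m) \<in> {(u, v). lt u v} \<Longrightarrow> c u = d u"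
    then have "(\<Sum>u | lt u m \<and> u \<in> ?L. c u * coeff (b u) m) =
        (\<Sum>u | lt u m \<and> u \<in> ?L. d u * coeff (b u) m)"
      by (intro sum.cong) auto
    then show "(m \<in> ?L \<longrightarrow> r * coeff (b m) m +
          (\<Sum>u | lt u m \<and> u \<in> ?L. c u * coeff (b u) m) = coeff f m) \<longleftrightarrow>
        (m \<in> ?L \<longrightarrow> r * coeff (b m) m +
          (\<Sum>u | lt u m \<and> u \<in> ?L. d u * coeff (b u) m) = coeff f m)"
      by simp
  next
    fix m and c :: "'x monomial \<Rightarrow> 'k"
    let ?s = "\<Sum>u | lt u m \<and> u \<in> ?L. c u * coeff (b u) m"
    show "\<exists>r. m \<in> ?L \<longrightarrow> r * coeff (b m) m + ?s = coeff f m"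
      using b by (intro exI [of _ "(coeff f m - ?s) / coeff (b m) m"]) (auto simp: is_lm_def)
  qed
  then obtain c where c: "\<And>m. m \<in> ?L \<Longrightarrow>
      c m * coeff (b m) m + (\<Sum>u | lt u m \<and> u \<in> ?L. c u * coeff (b u) m) = coeff f m"
    by blast
  let ?p = "\<lambda>n. \<Sum>u | deg u < n \<and> u \<in> ?L. scale (c u) (b u)"
  (* All terms of degree above deg m vanish at m, so h is the limit of its partial sums ?p n. *)
  define h where "h = Abs_mfps (\<lambda>m. coeff (?p (Suc (deg m))) m)"
  have fin: "finite {u. deg u < n \<and> u \<in> ?L}" for n
    by (rule finite_subset [OF _ finite_deg_less [of n]]) auto
  have vanish: "coeff (b u) m = 0" if "u \<in> ?L" "lt m u" for u m
    using b [OF that(1)] that(2) by (simp add: is_lm_def)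
  have deg_le: "deg u \<le> deg m" if "u \<in> ?L" "coeff (b u) m \<noteq> 0" for u m
    using that degree vanish [of u m] unfolding degree_compatible_def by (meson not_le)
  have "agree n (?p n) h" for n
    unfolding agree_def
  proof safe
    fix m :: "'x monomial" assume "deg m < n"
    then have "(\<Sum>u | deg u < n \<and> u \<in> ?L. c u * coeff (b u) m) =
        (\<Sum>u | deg u < Suc (deg m) \<and> u \<in> ?L. c u * coeff (b u) m)"
      using fin by (intro sum.mono_neutral_right) (auto simp: deg_le less_Suc_eq_le)
    then show "coeff (?p n) m = coeff h m" by (simp add: h_def coeff_sum)
  qed
  moreover have "?p n \<in> V" for n
    using bV V by (intro mfps_vs.subspace_sum mfps_vs.subspace_scale) auto
  ultimately have "h \<in> closure V"
    unfolding closure_iff_agree by blast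
  then have "h \<in> V" using closed by simp
  moreover have "coeff (f - h) m = 0" if m: "m \<in> ?L" for m
  proof -
    have "coeff h m = (\<Sum>u | deg u < Suc (deg m) \<and> u \<in> ?L. c u * coeff (b u) m)"
      by (simp add: h_def coeff_sum)
    also have "\<dots> = (\<Sum>u\<in>insert m {u. lt u m \<and> u \<in> ?L}. c u * coeff (b u) m)"
    proof (rule sum.mono_neutral_right)
      show "\<forall>u\<in>{u. deg u < Suc (deg m) \<and> u \<in> ?L} - insert m {u. lt u m \<and> u \<in> ?L}.
          c u * coeff (b u) m = 0"
      proof
        fix u assume "u \<in> {u. deg u < Suc (deg m) \<and> u \<in> ?L} - insert m {u. lt u m \<and> u \<in> ?L}"
        then have "u \<in> ?L" "lt m u" using total [of u m] by auto
        then show "c u * coeff (b u) m = 0" by (simp add: vanish)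
      qed
    qed (use fin [of "Suc (deg m)"] m deg_mono in \<open>auto simp: less_Suc_eq_le\<close>)
    also have "\<dots> = c m * coeff (b m) m + (\<Sum>u | lt u m \<and> u \<in> ?L. c u * coeff (b u) m)"
      using irrefl [of m] finite_subset [OF _ finite_below [of m]] by (subst sum.insert) auto
    finally show ?thesis using c [OF m] by simp
  qed
  ultimately show ?thesis by (intro exI [of _ "f - h"]) auto
qed

text \<open>
  The operator is the normal form of the division by \<open>V\<close>; all its properties follow from the
  uniqueness of the remainder.
\<close>

lemma ex_reduction_operator:
  fixes V :: "('x, 'k::field) mfps set"
  assumes V: "mfps_vs.subspace V" and closed: "closed V"
  shows "\<exists>T. reduction_operator lt T \<and> ker T = V"
proof -
  obtain T where TV: "\<And>f. f - T f \<in> V" and TL: "\<And>f m. m \<in> lm_set lt V \<Longrightarrow> coeff (T f) m = 0"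
    using ex_normal_form [OF assms] by metis
  have T_eqI: "T f = g" if "f - g \<in> V" "\<And>m. m \<in> lm_set lt V \<Longrightarrow> coeff g m = 0" for f g
  proof -
    have "(f - g) - (f - T f) \<in> V" using V that(1) TV by (rule mfps_vs.subspace_diff)
    then have "T f - g \<in> V" by simp
    then have "T f - g = 0"
      by (rule eq_0_if_avoids_lm_set) (simp add: TL that(2))
    then show ?thesis by simp
  qed
  (* Division does not create smaller monomials: this gives both the continuity of T and
     the decrease of monomials for the reduction order. *)
  have below: "coeff (T f) u = 0" if f: "\<And>v. v = u \<or> lt v u \<Longrightarrow> coeff f v = 0" for f u
  proof (rule ccontr)
    assume u: "coeff (T f) u \<noteq> 0"
    then have "T f \<noteq> 0" by auto
    then obtain m where m: "is_lm lt (T f) m" using ex_is_lm by blast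
    with u have "m = u \<or> lt m u" using total [of m u] by (auto simp: is_lm_def)
    then have "coeff f v = 0" if "v = m \<or> lt v m" for v
      using that f trans [of v m u] by blast
    then have "is_lm lt (f - T f) m"
      using m by (simp add: is_lm_def)
    then have "m \<in> lm_set lt V" using TV by (auto simp: lm_set_eq)
    then show False using m TL by (simp add: is_lm_def)
  qed
  have diff_V: "(f - T f) + (g - T g) \<in> V" "scale c (f - T f) \<in> V" for f g c
    using V TV by (simp_all add: mfps_vs.subspace_add mfps_vs.subspace_scale)
  have "T (f + g) = T f + T g" for f g
    using diff_V(1) [of f g] TL by (intro T_eqI) (simp_all add: algebra_simps)
  moreover have "T (scale c f) = scale c (T f)" for c f
    using diff_V(2) [of c f] TL by (intro T_eqI) (simp_all add: mfps_vs.scale_right_diff_distrib)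
  ultimately have lin: "Vector_Spaces.linear scale scale T"
    by (simp add: Vector_Spaces.linear_iff mfps_vs.vector_space_axioms)
  moreover have "continuous_on UNIV T"
    unfolding linear_continuous_iff_agree [OF lin]
  proof (intro allI exI impI)
    fix n and f :: "('x, 'k) mfps" assume "agree n f 0"
    then have "coeff (T f) u = 0" if "deg u < n" for u
      using that deg_mono by (intro below) (fastforce simp: agree_def)
    then show "agree n (T f) 0" by (simp add: agree_def)
  qed
  moreover have "T \<circ> T = T"
  proof (rule ext)
    fix f
    have "T (T f) = T f"
      by (rule T_eqI) (simp_all add: TL mfps_vs.subspace_0 [OF V])
    then show "(T \<circ> T) f = T f" by simp
  qed
  moreover have "lt m u" if m: "T (monom m) \<noteq> monom m" and u: "u \<in> supp (T (monom m))" for m u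
  proof -
    have "m \<in> lm_set lt V"
      using m mfps_vs.subspace_0 [OF V] by (auto simp: coeff_monom intro!: T_eqI split: if_splits)
    then have "u \<noteq> m" using u TL by (auto simp: supp_def)
    moreover have "\<not> lt u m"
    proof
      assume "lt u m"
      then have "coeff (T (monom m)) u = 0"
        using trans [of _ u m] irrefl [of m] by (intro below) (auto simp: coeff_monom)
      then show False using u by (simp add: supp_def)
    qed
    ultimately show ?thesis using total [of u m] by blast
  qed
  ultimately have "reduction_operator lt T"
    by (simp add: reduction_operator_def)
  moreover have "f \<in> ker T \<longleftrightarrow> f \<in> V" for f
    using TV [of f] T_eqI [of f 0] by (auto simp: ker_def)
  ultimately show ?thesis by blast
qed

lemma nf_reduction_operator:
  fixes T :: "('x, 'k::field) mfps_op"
  assumes "reduction_operator lt T"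
  shows "nf T = - lm_set lt (ker T)"
proof -
  have lin: "Vector_Spaces.linear scale scale T" and cont: "continuous_on UNIV T"
    and idem: "T (T f) = T f" and red: "T (monom m) \<noteq> monom m \<Longrightarrow> u \<in> supp (T (monom m)) \<Longrightarrow> lt m u"
    for f m u
    using assms by (auto simp: reduction_operator_def fun_eq_iff)
  interpret T: Vector_Spaces.linear scale scale T by fact
  note cont' = cont [unfolded linear_continuous_iff_agree [OF lin]]
  have "m \<in> lm_set lt (ker T)" if "m \<notin> nf T" for m
  proof -
    have m: "T (monom m) \<noteq> monom m" using that by (simp add: nf_def)
    have "is_lm lt (monom m - T (monom m)) m"
      using red [OF m] irrefl [of m] trans [of m _ m]
      by (auto simp: is_lm_def coeff_monom supp_def)
    moreover have "monom m - T (monom m) \<in> ker T"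
      by (simp add: ker_def T.diff idem)
    ultimately show ?thesis by (auto simp: lm_set_eq)
  qed
  moreover have "m \<notin> lm_set lt (ker T)" if m: "m \<in> nf T" for m
  proof
    assume "m \<in> lm_set lt (ker T)"
    then obtain f where f: "T f = 0" "is_lm lt f m" by (auto simp: lm_set_eq ker_def)
    (* Without its leading term, f has only monomials above m, and T never sends one of
       those to a series containing m. *)
    have "coeff (T (f - scale (coeff f m) (monom m))) m = 0"
    proof (rule coeff_continuous_linear [OF lin cont'])
      fix u assume "coeff (f - scale (coeff f m) (monom m)) u \<noteq> 0"
      then have "lt m u"
        using f total [of u m] by (auto simp: is_lm_def coeff_monom split: if_splits)
      then have "m \<noteq> u" "\<not> lt u m" using irrefl [of u] trans [of u m u] by auto
      then show "coeff (T (monom u)) m = 0"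
        using red [of u m] by (cases "T (monom u) = monom u") (auto simp: coeff_monom supp_def)
    qed
    with m f show False
      by (simp add: T.diff T.scale nf_def coeff_monom is_lm_def)
  qed
  ultimately show ?thesis by blast
qed

text \<open>
  The definition controls the images of monomials only by their order, so it does not
  say outright that images contain only normal forms. This follows from idempotence: the part
  \<open>r\<close> of \<open>T f\<close> outside the normal forms is again fixed by \<open>T\<close>, but \<open>T\<close> strictly moves its
  leading monomial away.
\<close>

lemma supp_reduction_operator:
  fixes T :: "('x, 'k::field) mfps_op"
  assumes T: "reduction_operator lt T"
  shows "supp (T f) \<subseteq> nf T"
proof -
  have lin: "Vector_Spaces.linear scale scale T" and cont: "continuous_on UNIV T"
    and idem: "T (T f) = T f" and red: "T (monom m) \<noteq> monom m \<Longrightarrow> u \<in> supp (T (monom m)) \<Longrightarrow> lt m u"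
    for f m u
    using assms by (auto simp: reduction_operator_def fun_eq_iff)
  interpret T: Vector_Spaces.linear scale scale T by fact
  note cont' = cont [unfolded linear_continuous_iff_agree [OF lin]]
  define h where "h = T f"
  define r where "r = Abs_mfps (\<lambda>m. if m \<in> nf T then 0 else coeff h m)"
  have "T r = r"
  proof -
    have lin': "Vector_Spaces.linear scale scale (\<lambda>f. T f - f)"
      using lin by (simp add: Vector_Spaces.linear_iff algebra_simps)
    have cont'': "\<forall>n. \<exists>N. \<forall>f. agree N f 0 \<longrightarrow> agree n (T f - f) 0"
    proof
      fix n
      obtain N where "\<And>f. agree N f 0 \<Longrightarrow> agree n (T f) 0" using cont' by blast
      then have "\<forall>f. agree (max n N) f 0 \<longrightarrow> agree n (T f - f) 0"
        by (auto simp: agree_def)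
      then show "\<exists>N. \<forall>f. agree N f 0 \<longrightarrow> agree n (T f - f) 0" by blast
    qed
    have "coeff (T (h - r) - (h - r)) u = 0" for u
      by (rule coeff_continuous_linear [OF lin' cont''])
        (auto simp: r_def nf_def split: if_splits)
    then have "T (h - r) - (h - r) = 0" by (simp add: mfps_eq_iff)
    then show ?thesis by (simp add: T.diff h_def idem)
  qed
  have "r = 0"
  proof (rule ccontr)
    assume "r \<noteq> 0"
    then obtain m where m: "is_lm lt r m" using ex_is_lm by blast
    have "coeff (T r) m = 0"
    proof (rule coeff_continuous_linear [OF lin cont'])
      fix u assume u: "coeff r u \<noteq> 0"
      then have "T (monom u) \<noteq> monom u" by (auto simp: r_def nf_def)
      moreover have "\<not> lt u m" using u m by (auto simp: is_lm_def)
      ultimately show "coeff (T (monom u)) m = 0"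
        using red by (auto simp: supp_def)
    qed
    with m \<open>T r = r\<close> show False by (simp add: is_lm_def)
  qed
  then show ?thesis
    by (auto simp: r_def h_def supp_def mfps_eq_iff split: if_splits)
qed

text \<open>
  The values of two operators with kernel \<open>V\<close> differ by an element of \<open>V\<close> supported outside
  the leading monomials of \<open>V\<close>, hence by \<open>0\<close>.
\<close>

lemma inj_on_ker:
  "inj_on ker {T :: ('x, 'k::field) mfps_op. reduction_operator lt T}"
proof (rule inj_onI, clarify, rule ext)
  fix S T :: "('x, 'k) mfps_op" and f
  assume S: "reduction_operator lt S" and T: "reduction_operator lt T" and eq: "ker S = ker T"
  have res: "f - U f \<in> ker U" if U: "reduction_operator lt U" for U :: "('x, 'k) mfps_op"
  proof -
    interpret U: Vector_Spaces.linear scale scale U using U by (simp add: reduction_operator_def)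
    show ?thesis using U by (simp add: reduction_operator_def ker_def U.diff fun_eq_iff)
  qed
  interpret T: Vector_Spaces.linear scale scale T using T by (simp add: reduction_operator_def)
  have "f - T f \<in> ker T" "f - S f \<in> ker T" using res S T eq by auto
  then have "S f - T f \<in> ker T" by (simp add: ker_def T.diff)
  moreover have "coeff (S f - T f) m = 0" if "m \<in> lm_set lt (ker T)" for m
  proof -
    have "m \<notin> supp (S f)" "m \<notin> supp (T f)"
      using that supp_reduction_operator [OF S, of f] supp_reduction_operator [OF T, of f]
      unfolding nf_reduction_operator [OF S] nf_reduction_operator [OF T] eq by blast+
    then show ?thesis by (simp add: supp_def)
  qed
  ultimately have "S f - T f = 0" by (rule eq_0_if_avoids_lm_set)
  then show "S f = T f" by simp
qed

lemma ker_inv_closure: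
  fixes V :: "('x, 'k::field) mfps set"
  assumes V: "mfps_vs.subspace V"
  shows "reduction_operator lt (ker_inv lt (closure V))"
    and "ker (ker_inv lt (closure V)) = closure V"
    and "nf (ker_inv lt (closure V)) = - lm_set lt V"
proof -
  obtain T where "reduction_operator lt T" "ker T = closure V"
    using ex_reduction_operator [OF subspace_closure [OF V] closed_closure] by blast
  then have T: "ker_inv lt (closure V) = T"
    using the_inv_into_f_f [OF inj_on_ker] unfolding ker_inv_def by fastforce
  show "reduction_operator lt (ker_inv lt (closure V))"
    and k: "ker (ker_inv lt (closure V)) = closure V"
    unfolding T by fact+
  then show "nf (ker_inv lt (closure V)) = - lm_set lt V"
    by (simp add: nf_reduction_operator lm_set_closure)
qed

end


section \<open>Ideals and sums of kernels\<close>

lemma subspace_ideal: "mfps_vs.subspace (ideal_of A)"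
  for A :: "('x::finite, 'k::field) mfps set"
proof (rule mfps_vs.subspaceI)
  fix c :: 'k and f assume "f \<in> ideal_of A"
  then have "scale c 1 * f \<in> ideal_of A" by (rule mfps_ideal.span_scale)
  moreover have "scale c 1 * f = scale c (1 * f)"
    by (simp only: mfps_eq_iff times_mfps_def coeff_Abs_mfps coeff_scale)
      (simp add: sum_distrib_left case_prod_beta mult.assoc)
  ultimately show "scale c f \<in> ideal_of A" by simp
qed (simp_all add: mfps_ideal.span_zero mfps_ideal.span_add)

lemma ker_sum_eq_span:
  assumes "\<And>T. T \<in> F \<Longrightarrow> mfps_vs.subspace (ker T)"
  shows "ker_sum F = mfps_vs.span (\<Union>T\<in>F. ker T)"
proof
  show "ker_sum F \<subseteq> mfps_vs.span (\<Union>T\<in>F. ker T)"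
    unfolding ker_sum_def by (clarify, intro mfps_vs.span_sum mfps_vs.span_base) blast
  show "mfps_vs.span (\<Union>T\<in>F. ker T) \<subseteq> ker_sum F"
  proof
    fix f assume "f \<in> mfps_vs.span (\<Union>T\<in>F. ker T)"
    then show "f \<in> ker_sum F"
    proof (induction rule: mfps_vs.span_induct_alt)
      case base
      have "0 = (\<Sum>T\<in>{}. 0)" by simp
      then show ?case unfolding ker_sum_def by blast
    next
      case (step c a f)
      then obtain T S g where T: "T \<in> F" "a \<in> ker T" and S: "finite S" "S \<subseteq> F"
        and g: "\<And>U. U \<in> S \<Longrightarrow> g U \<in> ker U" and f: "f = (\<Sum>U\<in>S. g U)"
        unfolding ker_sum_def by blast
      (* The operator T may occur in the sum already; its old component b is merged
         with the new one. *)
      define b where "b = (if T \<in> S then g T else 0)"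
      have b: "b \<in> ker T"
        using T g assms mfps_vs.subspace_0 by (auto simp: b_def)
      have "f = b + (\<Sum>U\<in>S - {T}. g U)"
        using S by (auto simp: f b_def sum.remove)
      then have "scale c a + f = (\<Sum>U\<in>insert T S. (g(T := scale c a + b)) U)"
        using S by (simp add: sum.insert_remove add.assoc)
      moreover have "scale c a + b \<in> ker T"
        using T b assms mfps_vs.subspace_add mfps_vs.subspace_scale by blast
      then have "\<forall>U\<in>insert T S. (g(T := scale c a + b)) U \<in> ker U"
        using g by auto
      ultimately show ?case
        unfolding ker_sum_def using S T by blast
    qed
  qed
qed

text \<open>
  The span is squeezed between the ideal and its closure: it contains each multiple \<open>c * f\<close> with
  \<open>f \<in> R\<close>, and the closure of the ideal is a subspace containing each of the summands.
\<close>

lemma closure_span_closures: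
  fixes R :: "('x::finite, 'k::field) mfps set"
  shows "closure (mfps_vs.span (\<Union>f\<in>R. closure (ideal_of {f}))) = closure (ideal_of R)"
proof (rule subset_antisym)
  let ?W = "mfps_vs.span (\<Union>f\<in>R. closure (ideal_of {f}))"
  have "?W \<subseteq> closure (ideal_of R)"
    by (intro mfps_vs.span_minimal subspace_closure subspace_ideal UN_least closure_mono
        mfps_ideal.span_mono) auto
  then show "closure ?W \<subseteq> closure (ideal_of R)"
    by (simp add: closure_minimal)
  have "f \<in> ?W" if "f \<in> ideal_of R" for f
    using that
  proof (induction rule: mfps_ideal.span_induct_alt)
    case base
    show ?case by (rule mfps_vs.span_zero)
  next
    case (step c a f)
    have "c * a \<in> ideal_of {a}"
      by (simp add: mfps_ideal.span_singleton)
    then have "c * a \<in> ?W"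
      using step closure_subset by (intro mfps_vs.span_base) blast
    then show ?case using step by (simp add: mfps_vs.span_add)
  qed
  then show "closure (ideal_of R) \<subseteq> closure ?W" by (intro closure_mono) blast
qed


section \<open>Standard bases and confluence\<close>

theorem proposition4p1p2:
  fixes lt :: "'x::finite monomial \<Rightarrow> 'x monomial \<Rightarrow> bool"
    and R :: "('x, 'k::field) mfps set"
  assumes "monomial_order lt" and "degree_compatible lt"
  shows "standard_basis lt (ideal_of R) R \<longleftrightarrow> confluent lt (op_of lt ` R)"
proof -
  interpret degree_order lt using assms by unfold_locales
  let ?F = "op_of lt ` R"
  have red: "reduction_operator lt (op_of lt f)"
    and ker: "ker (op_of lt f) = closure (ideal_of {f})"
    and nf: "nf (op_of lt f) = - {m. \<exists>u\<in>lm_set lt {f}. mdvd u m}" for f :: "('x, 'k) mfps"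
    using ker_inv_closure [OF subspace_ideal [of "{f}"]]
    by (simp_all add: op_of_def lm_set_principal_ideal)
  have "nf_set ?F = - {m. \<exists>u\<in>lm_set lt R. mdvd u m}"
    by (auto simp: nf_set_def nf lm_set_eq)
  moreover have "ker_sum ?F = mfps_vs.span (\<Union>f\<in>R. closure (ideal_of {f}))"
    by (subst ker_sum_eq_span) (auto simp: ker subspace_closure subspace_ideal)
  then have "meet lt ?F = ker_inv lt (closure (ideal_of R))"
    by (simp add: meet_def closure_span_closures)
  then have "nf (meet lt ?F) = - lm_set lt (ideal_of R)"
    by (simp add: ker_inv_closure subspace_ideal)
  ultimately show ?thesis
    by (auto simp: standard_basis_def confluent_def red)
qed

end
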